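(* Let $\mathcal{G}$ be a convex game with $N$ agents, local costs $\mathcal{C}_i(x_i,x_{-i})$ and action sets $\mathcal{X}_i$, $i=1,\ldots,N$. Suppose that $\mathcal{G}$ is $m$-strongly monotone, that for every $i$ the partial gradient $\nabla_i\mathcal{C}_i(x_i,x_{-i})$ is $L$-Lipschitz continuous in $x_{-i}$ for every $x_i\in\mathcal{X}_i$, i.e. $\|\nabla_i\mathcal{C}_i(x_i,x_{-i})-\nabla_i\mathcal{C}_i(x_i,x_{-i}')\|\le L\|x_{-i}-x_{-i}'\|$ for all $x_{-i},x_{-i}'\in\mathcal{X}_{-i}$, and that $m>L\sqrt{N-1}$. Let $x^*$ be the unique Nash equilibrium of $\mathcal{G}$, and let $(x_t)_{t\ge 1}$ be generated from $x_1\in\mathcal{X}$ by the best response algorithm $$x_{i,t+1}=\operatorname*{arg\,min}_{x_i\in\mathcal{X}_i}\mathcal{C}_i(x_i,x_{-i,t}),\qquad i=1,\ldots,N,\ t\ge 1.$$ Then, with $\rho:=\frac{L\sqrt{N-1}}{m}$, for every $T\ge 1$, $$\|x_T-x^*\|\le\rho^{T-1}\|x_1-x^*\|.$$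
   Context: There are $N$ agents indexed by $i\in\{1,\ldots,N\}$. Agent $i$ chooses an action $x_i$ in a nonempty closed convex subset $\mathcal{X}_i$ of a finite-dimensional Euclidean space. Write $\mathcal{X}=\prod_{i=1}^N\mathcal{X}_i$, $x=(x_1,\ldots,x_N)\in\mathcal{X}$, and let $x_{-i}\in\mathcal{X}_{-i}=\prod_{j\ne i}\mathcal{X}_j$ be the vector of actions of all agents other than $i$. All norms are Euclidean. Agent $i$ has a cost function $\mathcal{C}_i:\mathcal{X}\to\mathbb{R}$, $\mathcal{C}_i(x)=\mathcal{C}_i(x_i,x_{-i})$, which is convex and differentiable in $x_i$ for every $x_{-i}\in\mathcal{X}_{-i}$; $\nabla_i\mathcal{C}_i$ denotes its partial gradient with respect to $x_i$. A Nash equilibrium is a point $x^*\in\mathcal{X}$ with $\mathcal{C}_i(x^* )\le\mathcal{C}_i(x_i,x_{-i}^* )$ for all $x_i\in\mathcal{X}_i$ and all $i$; equivalently, $\langle\nabla_i\mathcal{C}_i(x^* ),x_i-x_i^*\rangle\ge 0$ for all $x_i\in\mathcal{X}_i$ and all $i$. The game is $m$-strongly monotone, with $m>0$, if for all $x,x'\in\mathcal{X}$, $$\sum_{i=1}^N\langle\nabla_i\mathcal{C}_i(x)-\nabla_i\mathcal{C}_i(x'),x_i-x_i'\rangle\ge m\|x-x'\|^2.$$ A strongly monotone game has a unique Nash equilibrium. In the bound, $0^0=1$. *)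

theory Defs
  imports "HOL-Analysis.Analysis"
begin

text \<open>
  The agents are the elements of a finite type \<open>'n\<close>, so \<open>N = CARD('n)\<close>. A joint action is a vector
  \<open>x :: 'a ^ 'n\<close> with blocks \<open>x $ i\<close>; the library norm on \<open>'a ^ 'n\<close> is the Euclidean norm of the
  stacked vector. The Euclidean spaces of the individual agents may have different dimensions:
  they are arbitrary subspaces \<open>E i\<close> of one common Euclidean space \<open>'a\<close>, and the actions and the
  partial gradients of agent \<open>i\<close> live in \<open>E i\<close>.
\<close>

definition profiles :: "('n::finite \<Rightarrow> 'a::euclidean_space set) \<Rightarrow> ('a ^ 'n) set" where
  "profiles X = {x. \<forall>i. x $ i \<in> X i}"

text \<open>\<open>deviate x i y\<close> is the joint action \<open>(y, x\<^bsub>-i\<^esub>)\<close>; the block \<open>x $ i\<close> is irrelevant.\<close>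

definition deviate :: "'a::euclidean_space ^ 'n::finite \<Rightarrow> 'n \<Rightarrow> 'a \<Rightarrow> 'a ^ 'n" where
  "deviate x i y = (\<chi> j. if j = i then y else x $ j)"

text \<open>The Euclidean distance between \<open>x\<^bsub>-i\<^esub>\<close> and \<open>x'\<^bsub>-i\<^esub>\<close>.\<close>

definition dist_others :: "'n::finite \<Rightarrow> 'a::euclidean_space ^ 'n \<Rightarrow> 'a ^ 'n \<Rightarrow> real" where
  "dist_others i x x' = L2_set (\<lambda>j. norm (x $ j - x' $ j)) (UNIV - {i})"

definition convex_game ::
  "('n::finite \<Rightarrow> 'a::euclidean_space set) \<Rightarrow> ('n \<Rightarrow> 'a set) \<Rightarrow> ('n \<Rightarrow> 'a ^ 'n \<Rightarrow> real) \<Rightarrow> bool" where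
  "convex_game E X C \<longleftrightarrow>
     (\<forall>i. subspace (E i) \<and> X i \<subseteq> E i \<and> X i \<noteq> {} \<and> closed (X i) \<and> convex (X i)) \<and>
     (\<forall>i. \<forall>x\<in>profiles X. convex_on (X i) (\<lambda>y. C i (deviate x i y)))"

text \<open>
  \<open>g i x\<close> is a partial gradient of \<open>C i\<close> with respect to the block \<open>x $ i\<close>. Costs matter only on
  \<open>profiles X\<close>, so differentiability is relative to the action set. The gradient is then unique if
  \<open>X i\<close> has nonempty interior in \<open>E i\<close>; otherwise \<open>g\<close> is any choice of gradients in \<open>E i\<close>.
\<close>

definition partial_gradients ::
  "('n::finite \<Rightarrow> 'a::euclidean_space set) \<Rightarrow> ('n \<Rightarrow> 'a set) \<Rightarrow> ('n \<Rightarrow> 'a ^ 'n \<Rightarrow> real) \<Rightarrow>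
   ('n \<Rightarrow> 'a ^ 'n \<Rightarrow> 'a) \<Rightarrow> bool" where
  "partial_gradients E X C g \<longleftrightarrow>
     (\<forall>i. \<forall>x\<in>profiles X. g i x \<in> E i \<and>
        ((\<lambda>y. C i (deviate x i y)) has_derivative (\<lambda>h. g i x \<bullet> h)) (at (x $ i) within X i))"

definition strongly_monotone ::
  "real \<Rightarrow> ('n::finite \<Rightarrow> 'a::euclidean_space set) \<Rightarrow> ('n \<Rightarrow> 'a ^ 'n \<Rightarrow> 'a) \<Rightarrow> bool" where
  "strongly_monotone m X g \<longleftrightarrow> m > 0 \<and>
     (\<forall>x\<in>profiles X. \<forall>x'\<in>profiles X.
        (\<Sum>i\<in>UNIV. (g i x - g i x') \<bullet> (x $ i - x' $ i)) \<ge> m * (norm (x - x'))\<^sup>2)"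

definition nash_equilibrium ::
  "('n::finite \<Rightarrow> 'a::euclidean_space set) \<Rightarrow> ('n \<Rightarrow> 'a ^ 'n \<Rightarrow> real) \<Rightarrow> 'a ^ 'n \<Rightarrow> bool" where
  "nash_equilibrium X C x \<longleftrightarrow> x \<in> profiles X \<and>
     (\<forall>i. \<forall>y\<in>X i. C i x \<le> C i (deviate x i y))"

text \<open>The sequence starts at index 1; the value \<open>x 0\<close> is unused.\<close>

definition best_response_sequence ::
  "('n::finite \<Rightarrow> 'a::euclidean_space set) \<Rightarrow> ('n \<Rightarrow> 'a ^ 'n \<Rightarrow> real) \<Rightarrow> (nat \<Rightarrow> 'a ^ 'n) \<Rightarrow> bool" where
  "best_response_sequence X C x \<longleftrightarrow> x 1 \<in> profiles X \<and>
     (\<forall>t\<ge>1. \<forall>i. is_arg_min (\<lambda>y. C i (deviate (x t) i y)) (\<lambda>y. y \<in> X i) (x (t + 1) $ i))"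

end

theory Submission
  imports Defs
begin

text \<open>
  Write \<open>y\<close> for the best response to \<open>x\<close>. Changing only block \<open>i\<close> of the equilibrium \<open>xs\<close> to \<open>y $ i\<close>,
  strong monotonicity bounds \<open>m * norm (y $ i - xs $ i)\<^sup>2\<close> by the increment of the \<open>i\<close>-th partial
  gradient tested against \<open>y $ i - xs $ i\<close>. The first-order optimality conditions of \<open>xs $ i\<close>
  (against \<open>xs\<^bsub>-i\<^esub>\<close>) and of \<open>y $ i\<close> (against \<open>x\<^bsub>-i\<^esub>\<close>) replace this increment by one in which
  only the other agents' actions differ, so the Lipschitz bound gives
  \<open>m * norm (y $ i - xs $ i) \<le> L * dist_others i xs x\<close>. Summing squares over \<open>i\<close> counts each block of
  \<open>xs - x\<close> exactly \<open>N - 1\<close> times, whence the contraction factor.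
\<close>

lemma deviate_nth: "deviate x i y $ j = (if j = i then y else x $ j)"
  by (simp add: deviate_def)

lemma deviate_deviate: "deviate (deviate x i y) i z = deviate x i z"
  by (simp add: vec_eq_iff deviate_nth)

lemma deviate_same: "deviate x i (x $ i) = x"
  by (simp add: vec_eq_iff deviate_nth)

lemma deviate_in_profiles: "x \<in> profiles X \<Longrightarrow> y \<in> X i \<Longrightarrow> deviate x i y \<in> profiles X"
  by (simp add: profiles_def deviate_nth)

text \<open>Along the segment from \<open>y\<close> to \<open>z\<close>, \<open>f\<close> starts
  with slope \<open>f' (z - y)\<close>; a negative slope would produce a point of \<open>S\<close>
  with a smaller value.\<close>

lemma convex_minimum_first_order:
  fixes f :: "'a::real_normed_vector \<Rightarrow> real"
  assumes "convex S" "y \<in> S" "z \<in> S"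
    and der: "(f has_derivative f') (at y within S)"
    and min: "\<And>u. u \<in> S \<Longrightarrow> f y \<le> f u"
  shows "f' (z - y) \<ge> 0"
proof (rule ccontr)
  assume "\<not> f' (z - y) \<ge> 0"
  define p where "p t = y + t *\<^sub>R (z - y)" for t
  have p_in: "p t \<in> S" if "t \<in> {0..1}" for t
    using convexD_alt[OF assms(1-3), of t] that by (simp add: p_def algebra_simps)
  have "(p has_derivative (\<lambda>h. h *\<^sub>R (z - y))) (at 0 within {0..1})"
    unfolding p_def by (auto intro!: derivative_eq_intros)
  moreover have "(f has_derivative f') (at (p 0) within p ` {0..1})"
    using der p_in by (auto simp: p_def intro: has_derivative_subset)
  ultimately have "((f \<circ> p) has_derivative (f' \<circ> (\<lambda>h. h *\<^sub>R (z - y)))) (at 0 within {0..1})"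
    by (rule diff_chain_within)
  moreover have "f' \<circ> (\<lambda>h. h *\<^sub>R (z - y)) = (*) (f' (z - y))"
    using linear_scale[OF has_derivative_linear[OF der]] by (auto simp: fun_eq_iff)
  ultimately have "((f \<circ> p) has_real_derivative f' (z - y)) (at 0 within {0..1})"
    by (simp add: has_field_derivative_def)
  from has_real_derivative_neg_dec_right[OF this] \<open>\<not> f' (z - y) \<ge> 0\<close>
  obtain d where d: "d > 0" "\<And>h. h > 0 \<Longrightarrow> h \<in> {0..1} \<Longrightarrow> h < d \<Longrightarrow> f (p h) < f (p 0)"
    by auto
  \<comment> \<open>The cap 1 keeps \<open>p h\<close> on the segment, hence in \<open>S\<close>;
    halving \<open>d\<close> gives \<open>h < d\<close>.\<close>
  define h where "h = min 1 (d / 2)"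
  have "h > 0" "h \<in> {0..1}" "h < d" using d(1) by (auto simp: h_def)
  with d(2)[of h] min[OF p_in[of h]] show False by (simp add: p_def)
qed

lemma best_response_first_order:
  assumes "convex_game E X C" "partial_gradients E X C g"
    and "z \<in> profiles X" "y \<in> X i" "w \<in> X i"
    and min: "\<And>u. u \<in> X i \<Longrightarrow> C i (deviate z i y) \<le> C i (deviate z i u)"
  shows "g i (deviate z i y) \<bullet> (w - y) \<ge> 0"
proof -
  \<comment> \<open>The gradient is taken at the profile \<open>deviate z i y\<close>, whose block
    \<open>i\<close> is already \<open>y\<close>.\<close>
  have "((\<lambda>u. C i (deviate (deviate z i y) i u)) has_derivative (\<lambda>h. g i (deviate z i y) \<bullet> h))
      (at (deviate z i y $ i) within X i)"
    using assms(2) deviate_in_profiles[OF assms(3,4)] unfolding partial_gradients_def by blast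
  then have "((\<lambda>u. C i (deviate z i u)) has_derivative (\<lambda>h. g i (deviate z i y) \<bullet> h))
      (at y within X i)"
    by (simp add: deviate_deviate deviate_nth)
  moreover have "convex (X i)"
    using assms(1) by (simp add: convex_game_def)
  ultimately show ?thesis
    using convex_minimum_first_order[where f = "\<lambda>u. C i (deviate z i u)"] assms(4,5) min by blast
qed

text \<open>Two profiles that differ only in block \<open>i\<close> leave a single term of the
  monotonicity sum.\<close>

lemma strongly_monotone_deviate:
  assumes "strongly_monotone m X g" "z \<in> profiles X" "y \<in> X i"
  shows "m * (norm (y - z $ i))\<^sup>2 \<le> (g i (deviate z i y) - g i z) \<bullet> (y - z $ i)"
proof -
  let ?a = "deviate z i y"
  have block: "?a $ j - z $ j = (if j = i then y - z $ i else 0)" for j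
    by (simp add: deviate_nth)
  have "(norm (?a - z))\<^sup>2 = (norm (y - z $ i))\<^sup>2"
    by (simp add: norm_vec_def L2_set_def sum_nonneg block if_distrib if_distribR cong: if_cong)
  moreover have "(\<Sum>j\<in>UNIV. (g j ?a - g j z) \<bullet> (?a $ j - z $ j)) = (g i ?a - g i z) \<bullet> (y - z $ i)"
    unfolding block by (simp add: if_distrib cong: if_cong)
  moreover have "m * (norm (?a - z))\<^sup>2 \<le> (\<Sum>j\<in>UNIV. (g j ?a - g j z) \<bullet> (?a $ j - z $ j))"
    using assms(1,2) deviate_in_profiles[OF assms(2,3)] unfolding strongly_monotone_def by blast
  ultimately show ?thesis by (simp only:)
qed

lemma sum_dist_others_power2:
  fixes x x' :: "'a::euclidean_space ^ 'n::finite"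
  shows "(\<Sum>i\<in>UNIV. (dist_others i x x')\<^sup>2) = (real CARD('n) - 1) * (norm (x - x'))\<^sup>2"
proof -
  let ?d = "\<lambda>j. (norm (x $ j - x' $ j))\<^sup>2"
  have norm: "(norm (x - x'))\<^sup>2 = sum ?d UNIV"
    by (simp add: norm_vec_def L2_set_def sum_nonneg)
  have "(dist_others i x x')\<^sup>2 = sum ?d UNIV - ?d i" for i
    by (simp add: dist_others_def L2_set_def sum_nonneg sum.remove[of UNIV i ?d])
  then have "(\<Sum>i\<in>UNIV. (dist_others i x x')\<^sup>2) = real CARD('n) * sum ?d UNIV - sum ?d UNIV"
    by (simp add: sum_subtractf)
  then show ?thesis
    by (simp add: norm algebra_simps)
qed

lemma best_response_block_bound:
  assumes game: "convex_game E X C" "partial_gradients E X C g" "strongly_monotone m X g"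
    and lip: "norm (g i (deviate xs i y) - g i (deviate z i y)) \<le> L * dist_others i xs z"
    and nash: "nash_equilibrium X C xs"
    and z: "z \<in> profiles X"
    and y: "is_arg_min (\<lambda>y. C i (deviate z i y)) (\<lambda>y. y \<in> X i) y"
  shows "m * norm (y - xs $ i) \<le> L * dist_others i xs z"
proof -
  let ?e = "y - xs $ i"
  have xs: "xs \<in> profiles X" "xs $ i \<in> X i"
    using nash by (auto simp: nash_equilibrium_def profiles_def)
  have yX: "y \<in> X i"
    using y by (simp add: is_arg_min_linorder)
  have "g i (deviate z i y) \<bullet> (xs $ i - y) \<ge> 0"
    using y by (intro best_response_first_order[OF game(1,2) z yX xs(2)])
      (simp add: is_arg_min_linorder)
  moreover have "g i (deviate xs i (xs $ i)) \<bullet> ?e \<ge> 0"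
    using nash by (intro best_response_first_order[OF game(1,2) xs yX])
      (simp add: deviate_same nash_equilibrium_def)
  \<comment> \<open>As \<open>xs $ i - y\<close> is \<open>- ?e\<close>, the conditions give
    \<open>g i (deviate z i y) \<bullet> ?e \<le> 0 \<le> g i xs \<bullet> ?e\<close>, so
    subtracting the former instead of the latter only enlarges the bound.\<close>
  ultimately have "m * (norm ?e)\<^sup>2 \<le> (g i (deviate xs i y) - g i (deviate z i y)) \<bullet> ?e"
    using strongly_monotone_deviate[OF game(3) xs(1) yX]
    by (simp add: deviate_same inner_diff_left inner_diff_right)
  also have "\<dots> \<le> norm (g i (deviate xs i y) - g i (deviate z i y)) * norm ?e"
    by (rule norm_cauchy_schwarz)
  also have "\<dots> \<le> L * dist_others i xs z * norm ?e"
    using lip by (rule mult_right_mono) simp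
  finally have "(m * norm ?e) * norm ?e \<le> (L * dist_others i xs z) * norm ?e"
    by (simp add: power2_eq_square mult.assoc)
  \<comment> \<open>This settles the case \<open>norm ?e = 0\<close>, where the factor cannot be
    cancelled.\<close>
  moreover have "0 \<le> L * dist_others i xs z"
    using norm_ge_zero lip by (rule order_trans)
  ultimately show ?thesis
    by (cases "norm ?e = 0") (simp_all add: mult_le_cancel_right)
qed

text \<open>The block bounds are squared and summed; taking roots then requires a nonnegative
  right-hand side, which is checked for either sign of \<open>L\<close>.\<close>

lemma norm_le_of_dist_others:
  fixes e z z' :: "'a::euclidean_space ^ 'n::finite"
  assumes "m > 0"
    and bound: "\<And>i. m * norm (e $ i) \<le> L * dist_others i z z'"
  shows "norm e \<le> L * sqrt (real CARD('n) - 1) / m * norm (z - z')"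
proof -
  let ?s = "sqrt (real CARD('n) - 1)"
  have N: "real CARD('n) - 1 \<ge> 0"
    using zero_less_card_finite[where 'a = 'n] by linarith
  have nonneg: "0 \<le> L * dist_others i z z'" for i
    using bound[of i] assms(1) by (smt (verit) mult_nonneg_nonneg norm_ge_zero)
  have "(m * norm e)\<^sup>2 = (\<Sum>i\<in>UNIV. (m * norm (e $ i))\<^sup>2)"
    by (simp add: norm_vec_def L2_set_def sum_nonneg power_mult_distrib sum_distrib_left)
  also have "\<dots> \<le> (\<Sum>i\<in>UNIV. (L * dist_others i z z')\<^sup>2)"
    using bound assms(1) by (intro sum_mono power_mono) auto
  also have "\<dots> = (L * ?s * norm (z - z'))\<^sup>2"
    using N by (simp add: power_mult_distrib sum_distrib_left[symmetric] sum_dist_others_power2)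
  finally have sq: "(m * norm e)\<^sup>2 \<le> (L * ?s * norm (z - z'))\<^sup>2" .
  \<comment> \<open>If \<open>L < 0\<close>, the hypothesis forces \<open>z\<^bsub>-i\<^esub> = z'\<^bsub>-i\<^esub>\<close> for all \<open>i\<close>.\<close>
  have "0 \<le> L * ?s * norm (z - z')"
  proof (cases "L \<ge> 0")
    case False
    have "dist_others i z z' = 0" for i
      using nonneg[of i] False by (simp add: zero_le_mult_iff dist_others_def order_antisym)
    \<comment> \<open>With all distances zero, the identity leaves only N = 1 or
      \<open>z = z'\<close>.\<close>
    then have "(?s * norm (z - z'))\<^sup>2 = 0"
      using sum_dist_others_power2[of z z'] N by (simp add: power_mult_distrib)
    then show ?thesis by auto
  qed (use N in simp)
  with sq have "m * norm e \<le> L * ?s * norm (z - z')"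
    by (rule power2_le_imp_le)
  then show ?thesis
    using assms(1) by (simp add: field_simps)
qed

text \<open>The ratio may be negative: then each \<open>a t\<close> vanishes.\<close>

lemma geometric_decay:
  fixes a :: "nat \<Rightarrow> real"
  assumes nonneg: "\<And>t. a t \<ge> 0"
    and step: "\<And>t. t \<ge> 1 \<Longrightarrow> a (Suc t) \<le> r * a t"
    and "T \<ge> 1"
  shows "a T \<le> r ^ (T - 1) * a 1"
proof (cases "r \<ge> 0")
  case True
  from \<open>T \<ge> 1\<close> show ?thesis
  proof (induction T rule: dec_induct)
    case (step t)
    have "a (Suc t) \<le> r * (r ^ (t - 1) * a 1)"
      using assms(2)[OF step(1)] mult_left_mono[OF step(3) True] by linarith
    \<comment> \<open>Since \<open>t \<ge> 1\<close>, the truncated exponent satisfies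
      \<open>r * r ^ (t - 1) = r ^ t\<close>.\<close>
    then show ?case
      using step(1) by (cases t) (simp_all add: mult.assoc)
  qed simp
next
  case False
  have "a t = 0" if "t \<ge> 1" for t
  proof -
    have "0 \<le> r * a t"
      using nonneg[of "Suc t"] step[OF that] by linarith
    with False nonneg[of t] show ?thesis
      by (simp add: zero_le_mult_iff)
  qed
  with \<open>T \<ge> 1\<close> show ?thesis by simp
qed

theorem proposition1:
  fixes E X :: "'n::finite \<Rightarrow> 'a::euclidean_space set"
    and C :: "'n \<Rightarrow> 'a ^ 'n \<Rightarrow> real"
    and g :: "'n \<Rightarrow> 'a ^ 'n \<Rightarrow> 'a"
    and m L :: real
    and xs :: "'a ^ 'n"
    and x :: "nat \<Rightarrow> 'a ^ 'n"
    and T :: nat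
  assumes "convex_game E X C"
    and "partial_gradients E X C g"
    and "strongly_monotone m X g"
    and "\<And>i y z z'. y \<in> X i \<Longrightarrow> z \<in> profiles X \<Longrightarrow> z' \<in> profiles X \<Longrightarrow>
           norm (g i (deviate z i y) - g i (deviate z' i y)) \<le> L * dist_others i z z'"
    and "m > L * sqrt (real CARD('n) - 1)"
    and "nash_equilibrium X C xs"
    and "best_response_sequence X C x"
    and "T \<ge> 1"
  shows "norm (x T - xs) \<le> (L * sqrt (real CARD('n) - 1) / m) ^ (T - 1) * norm (x 1 - xs)"
proof (rule geometric_decay[OF _ _ \<open>T \<ge> 1\<close>])
  fix t :: nat
  assume t: "t \<ge> 1"
  have xs: "xs \<in> profiles X"
    using assms(6) by (simp add: nash_equilibrium_def)
  have arg_min: "is_arg_min (\<lambda>y. C i (deviate (x s) i y)) (\<lambda>y. y \<in> X i) (x (Suc s) $ i)"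
    if "s \<ge> 1" for s i
    using assms(7) that by (simp add: best_response_sequence_def)
  \<comment> \<open>The gradient hypotheses hold only on \<open>profiles X\<close>; iterates stay
    there because each new block minimises over \<open>X i\<close>.\<close>
  have prof: "x s \<in> profiles X" if "s \<ge> 1" for s
    using that
  proof (induction s rule: dec_induct)
    case base
    show ?case using assms(7) by (simp add: best_response_sequence_def)
  next
    case (step s)
    show ?case using arg_min[OF step(1)] by (simp add: profiles_def is_arg_min_linorder)
  qed
  \<comment> \<open>The Lipschitz hypothesis enters with the own action fixed at the new block
    \<open>x (Suc t) $ i\<close> and the profiles \<open>xs\<close> and \<open>x t\<close>.\<close>
  have bound: "m * norm ((x (Suc t) - xs) $ i) \<le> L * dist_others i xs (x t)" for i
    unfolding vector_minus_component
    using arg_min[OF t, of i] xs prof[OF t]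
    by (intro best_response_block_bound[OF assms(1-3) _ assms(6)] assms(4))
      (auto simp: is_arg_min_linorder)
  have "m > 0"
    using assms(3) by (simp add: strongly_monotone_def)
  from norm_le_of_dist_others[OF this bound]
  show "norm (x (Suc t) - xs) \<le> L * sqrt (real CARD('n) - 1) / m * norm (x t - xs)"
    by (simp add: norm_minus_commute)
qed simp

end
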